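(* Let $\mathcal{H} = \{H_n\}_{n=0}^{\infty}$ and $\mathcal{R} = \{R_n\}_{n=0}^{\infty}$ be sequences of nonempty finite sets of positive integers. Then: (i) If $A$ is a basis of order $\mathcal{H}$, or if $A$ is a finite basis of order $\mathcal{H}$ with $\max(A) \geq 1$, then $0,1 \in A$. (ii) If $A$ is an $\mathcal{R}$-basis of order $\mathcal{H}$, or if $A$ is a finite $\mathcal{R}$-basis of order $\mathcal{H}$ with $\max(A) \geq 1$, then $|H_0| \in R_0$ and $|H_1| \in R_1$. (iii) If $A$ is an $\mathcal{R}$-basis of order $\mathcal{H}$, then $A_N = A \cap [0,N]$ is a finite $\mathcal{R}$-basis of order $\mathcal{H}$ for every $N \geq 0$. (iv) If $A \neq \{0\}$ is a finite $\mathcal{R}$-basis of order $\mathcal{H}$, then $A \setminus \{\max(A)\}$ is also a finite $\mathcal{R}$-basis of order $\mathcal{H}$.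
   Context: For a set $A$ of nonnegative integers, a nonnegative integer $n$ and a positive integer $h$, $r_A(n,h)$ denotes the number of representations $n = a_1 + \cdots + a_h$ with $a_1,\ldots,a_h \in A$ and $a_1 \leq \cdots \leq a_h$; and $r_A(n,H_n) = \sum_{h_n \in H_n} r_A(n,h_n)$. For real $a,b$, $[a,b]$ denotes the set of integers $n$ with $a\le n\le b$; $|X|$ is the cardinality of $X$. A set $A$ of nonnegative integers is a basis of order $\mathcal{H}$ if $r_A(n,H_n)\ge 1$ for all $n\ge 0$, and an $\mathcal{R}$-basis of order $\mathcal{H}$ if $r_A(n,H_n)\in R_n$ for all $n\ge 0$. A nonempty finite set $A$ of nonnegative integers is a finite basis of order $\mathcal{H}$ if $r_A(n,H_n)\ge 1$ for all $n \in [0,\max(A)]$, and a finite $\mathcal{R}$-basis of order $\mathcal{H}$ if $r_A(n,H_n)\in R_n$ for all $n\in[0,\max(A)]$. *)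

theory Defs imports Main begin

definition rep_lists :: "nat set \<Rightarrow> nat \<Rightarrow> nat \<Rightarrow> nat list set" where
  "rep_lists A n h = {as. length as = h \<and> sorted as \<and> set as \<subseteq> A \<and> sum_list as = n}"

definition rep_count :: "nat set \<Rightarrow> nat \<Rightarrow> nat \<Rightarrow> nat" where
  "rep_count A n h = card (rep_lists A n h)"

text \<open>All entries of a representation of \<open>n\<close> are at most \<open>n\<close>, so \<^const>\<open>card\<close> is the genuine
  number of representations even when \<open>A\<close> is infinite.\<close>

lemma finite_rep_lists: "finite (rep_lists A n h)"
proof (rule finite_subset)
  show "rep_lists A n h \<subseteq> {as. set as \<subseteq> {..n} \<and> length as = h}"
    by (auto simp: rep_lists_def member_le_sum_list)
  show "finite {as. set as \<subseteq> {..n} \<and> length as = h}"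
    by (rule finite_lists_length_eq) simp
qed

definition rep_sum :: "nat set \<Rightarrow> nat \<Rightarrow> nat set \<Rightarrow> nat" where
  "rep_sum A n Hn = (\<Sum>h\<in>Hn. rep_count A n h)"

definition basis_of_order :: "(nat \<Rightarrow> nat set) \<Rightarrow> nat set \<Rightarrow> bool" where
  "basis_of_order H A \<longleftrightarrow> (\<forall>n. rep_sum A n (H n) \<ge> 1)"

definition R_basis_of_order :: "(nat \<Rightarrow> nat set) \<Rightarrow> (nat \<Rightarrow> nat set) \<Rightarrow> nat set \<Rightarrow> bool" where
  "R_basis_of_order R H A \<longleftrightarrow> (\<forall>n. rep_sum A n (H n) \<in> R n)"

definition finite_basis_of_order :: "(nat \<Rightarrow> nat set) \<Rightarrow> nat set \<Rightarrow> bool" where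
  "finite_basis_of_order H A \<longleftrightarrow>
     finite A \<and> A \<noteq> {} \<and> (\<forall>n\<in>{0..Max A}. rep_sum A n (H n) \<ge> 1)"

definition finite_R_basis_of_order ::
    "(nat \<Rightarrow> nat set) \<Rightarrow> (nat \<Rightarrow> nat set) \<Rightarrow> nat set \<Rightarrow> bool" where
  "finite_R_basis_of_order R H A \<longleftrightarrow>
     finite A \<and> A \<noteq> {} \<and> (\<forall>n\<in>{0..Max A}. rep_sum A n (H n) \<in> R n)"

end

theory Submission imports Defs begin

text \<open>A representation of \<open>n\<close> uses only elements of \<open>A \<inter> [0,n]\<close>, so truncating \<open>A\<close> above \<open>n\<close> does
  not change the number of representations; this gives (iii) and (iv). For (i) and (ii), note that
  \<open>0 = 0 + \<cdots> + 0\<close> and \<open>1 = 0 + \<cdots> + 0 + 1\<close> are the only representations of 0 and 1 with \<open>h\<close> summands.\<close>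

lemma rep_lists_cong:
  assumes "A \<inter> {0..n} = B \<inter> {0..n}"
  shows "rep_lists A n h = rep_lists B n h"
proof -
  have "set as \<subseteq> A \<longleftrightarrow> set as \<subseteq> B" if "sum_list as = n" for as
    using assms that member_le_sum_list[of _ as] by fastforce
  then show ?thesis
    unfolding rep_lists_def by blast
qed

lemma rep_sum_cong:
  assumes "A \<inter> {0..n} = B \<inter> {0..n}"
  shows "rep_sum A n K = rep_sum B n K"
  unfolding rep_sum_def rep_count_def using rep_lists_cong[OF assms] by simp

lemma rep_sum_posE:
  assumes "rep_sum A n K \<ge> 1"
  obtains h as where "h \<in> K" "as \<in> rep_lists A n h"
proof -
  from assms obtain h where "h \<in> K" "rep_count A n h \<noteq> 0"
    unfolding rep_sum_def by (metis not_one_le_zero sum.neutral)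
  moreover from this have "rep_lists A n h \<noteq> {}"
    by (auto simp: rep_count_def)
  ultimately show ?thesis using that by blast
qed

lemma sum_list_eq_0_replicate:
  fixes as :: "nat list"
  assumes "sum_list as = 0"
  shows "as = replicate (length as) 0"
  using assms by (simp add: replicate_eqI)

text \<open>Sorting puts the largest entry last. If it were 0, all entries and hence the sum would
  vanish; so it is 1, which leaves 0 for the rest.\<close>

lemma sum_list_eq_1_sorted:
  fixes as :: "nat list"
  assumes "sorted as" "sum_list as = 1"
  shows "as = replicate (length as - 1) 0 @ [1]"
proof (cases as rule: rev_cases)
  case Nil
  with assms show ?thesis by simp
next
  case (snoc bs x)
  have "x \<noteq> 0"
  proof
    assume "x = 0"
    with snoc assms have "\<forall>y\<in>set bs. y = 0" by (auto simp: sorted_append)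
    then have "sum_list bs = 0" by simp
    with snoc assms \<open>x = 0\<close> show False by simp
  qed
  moreover have "sum_list bs + x = 1" using snoc assms by simp
  ultimately have "x = 1" "sum_list bs = 0" by linarith+
  from sum_list_eq_0_replicate[OF this(2)] \<open>x = 1\<close> snoc show ?thesis
    by simp
qed

text \<open>The assumption \<open>0 \<notin> K\<close> excludes the empty list, which represents 0
  over any set; a nonempty list with sum 0 exhibits 0 as a member of \<open>A\<close>.\<close>

lemma zero_mem_if_rep_sum_pos:
  assumes "rep_sum A 0 K \<ge> 1" "0 \<notin> K"
  shows "0 \<in> A"
proof -
  obtain h as where "h \<in> K" "as \<in> rep_lists A 0 h"
    using rep_sum_posE assms(1) .
  then have "as \<noteq> []" "set as \<subseteq> A" "\<forall>a\<in>set as. a = 0"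
    using assms(2) by (auto simp: rep_lists_def)
  then show ?thesis
    by (metis list.set_intros(1) neq_Nil_conv subsetD)
qed

lemma one_mem_if_rep_sum_pos:
  assumes "rep_sum A 1 K \<ge> 1"
  shows "1 \<in> A"
proof -
  obtain h as where as: "as \<in> rep_lists A 1 h"
    using rep_sum_posE assms .
  then have "as = replicate (length as - 1) 0 @ [1]"
    by (intro sum_list_eq_1_sorted) (auto simp: rep_lists_def)
  then have "1 \<in> set as"
    by (metis in_set_conv_decomp)
  with as show ?thesis
    by (auto simp: rep_lists_def)
qed

lemma rep_sum_0:
  assumes "0 \<in> A"
  shows "rep_sum A 0 K = card K"
proof -
  have "rep_lists A 0 h = {replicate h 0}" for h
    using assms by (auto simp: rep_lists_def sum_list_replicate intro: replicate_eqI)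
  then show ?thesis
    by (simp add: rep_sum_def rep_count_def)
qed

lemma rep_sum_1:
  assumes "0 \<in> A" "1 \<in> A" "0 \<notin> K"
  shows "rep_sum A 1 K = card K"
proof -
  have "rep_lists A 1 h = {replicate (h - 1) 0 @ [1]}" if "h \<in> K" for h
  proof -
    \<comment> \<open>Subtraction on naturals truncates, so only for positive \<open>h\<close> does
      the list with \<open>h - 1\<close> zeros and a final 1 have length \<open>h\<close>.\<close>
    have "h > 0" using that assms(3) by (metis gr0I)
    then have "replicate (h - 1) 0 @ [1] \<in> rep_lists A 1 h"
      using assms by (auto simp: rep_lists_def sum_list_replicate sorted_append)
    moreover have "as = replicate (h - 1) 0 @ [1]" if "as \<in> rep_lists A 1 h" for as
    proof -
      from that have "length as = h" "sorted as" "sum_list as = 1"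
        by (simp_all add: rep_lists_def)
      with sum_list_eq_1_sorted[of as] show ?thesis by metis
    qed
    ultimately show ?thesis by blast
  qed
  then show ?thesis
    by (simp add: rep_sum_def rep_count_def)
qed

text \<open>Common core of (iii) and (iv): the equation for \<open>B\<close> makes it an initial
  segment of \<open>A\<close>, so the counts for \<open>A\<close> and \<open>B\<close> agree up to
  \<open>Max B\<close>. Membership of 0 keeps \<open>B\<close> nonempty.\<close>

lemma finite_R_basis_of_order_restrict:
  assumes B: "finite B" "0 \<in> B" "B = A \<inter> {0..Max B}"
    and R: "\<And>n. n \<le> Max B \<Longrightarrow> rep_sum A n (H n) \<in> R n"
  shows "finite_R_basis_of_order R H B"
proof -
  have "rep_sum B n (H n) \<in> R n" if "n \<le> Max B" for n
  proof -
    have "B \<inter> {0..n} = A \<inter> {0..n}"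
      by (subst B(3)) (use that in auto)
    from rep_sum_cong[OF this] R[OF that] show ?thesis by simp
  qed
  with B show ?thesis
    by (auto simp: finite_R_basis_of_order_def)
qed

theorem theorem2:
  fixes H R :: "nat \<Rightarrow> nat set" and A :: "nat set"
  assumes H: "\<And>n. finite (H n) \<and> H n \<noteq> {} \<and> (\<forall>h\<in>H n. h > 0)"
    and R: "\<And>n. finite (R n) \<and> R n \<noteq> {} \<and> (\<forall>r\<in>R n. r > 0)"
  shows "(basis_of_order H A \<or> (finite_basis_of_order H A \<and> Max A \<ge> 1) \<longrightarrow> 0 \<in> A \<and> 1 \<in> A)
    \<and> (R_basis_of_order R H A \<or> (finite_R_basis_of_order R H A \<and> Max A \<ge> 1) \<longrightarrow>
         card (H 0) \<in> R 0 \<and> card (H 1) \<in> R 1)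
    \<and> (R_basis_of_order R H A \<longrightarrow> (\<forall>N. finite_R_basis_of_order R H (A \<inter> {0..N})))
    \<and> (A \<noteq> {0} \<and> finite_R_basis_of_order R H A \<longrightarrow>
         finite_R_basis_of_order R H (A - {Max A}))"
proof (intro conjI impI allI)
  have H0: "0 \<notin> H n" for n using H[of n] by blast
  \<comment> \<open>Positivity of the members of \<open>R n\<close> turns the
    \<open>R\<close>-conditions into basis conditions, so \<open>mem\<close> applies to them
    too.\<close>
  have pos: "r \<ge> 1" if "r \<in> R n" for r n using R[of n] that by (simp add: Suc_leI)
  note mem = zero_mem_if_rep_sum_pos[OF _ H0] one_mem_if_rep_sum_pos
  {
    assume "basis_of_order H A \<or> (finite_basis_of_order H A \<and> Max A \<ge> 1)"
    \<comment> \<open>In the finite case, \<open>Max A \<ge> 1\<close> puts both 0 and 1 in the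
      range of the condition.\<close>
    then have "rep_sum A 0 (H 0) \<ge> 1" "rep_sum A 1 (H 1) \<ge> 1"
      by (auto simp: basis_of_order_def finite_basis_of_order_def)
    then show "0 \<in> A" "1 \<in> A" using mem by blast+
  }
  {
    assume "R_basis_of_order R H A \<or> (finite_R_basis_of_order R H A \<and> Max A \<ge> 1)"
    then have *: "rep_sum A 0 (H 0) \<in> R 0" "rep_sum A 1 (H 1) \<in> R 1"
      by (auto simp: R_basis_of_order_def finite_R_basis_of_order_def)
    have "0 \<in> A" "1 \<in> A" using *[THEN pos] mem by blast+
    with * show "card (H 0) \<in> R 0" "card (H 1) \<in> R 1"
      using rep_sum_0[of A "H 0"] rep_sum_1[of A "H 1"] H0 by simp_all
  }
  {
    fix N
    assume *: "R_basis_of_order R H A"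
    have "0 \<in> A"
      using * pos by (intro mem(1)) (auto simp: R_basis_of_order_def)
    \<comment> \<open>The bound \<open>N\<close> need not lie in \<open>A\<close>, so the cut is
      moved down to the largest element that survives; 0 guarantees that there is one.\<close>
    moreover from this have "Max (A \<inter> {0..N}) \<in> A \<inter> {0..N}"
      by (intro Max_in) auto
    ultimately show "finite_R_basis_of_order R H (A \<inter> {0..N})"
      using * by (intro finite_R_basis_of_order_restrict[where A = A])
        (auto simp: R_basis_of_order_def)
  }
  {
    assume *: "A \<noteq> {0} \<and> finite_R_basis_of_order R H A"
    then have fin: "finite A" and rep: "\<And>n. n \<le> Max A \<Longrightarrow> rep_sum A n (H n) \<in> R n"
      by (auto simp: finite_R_basis_of_order_def)
    let ?B = "A - {Max A}"
    have "0 \<in> A" using mem(1)[OF pos[OF rep[of 0]]] by simp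
    \<comment> \<open>This ensures that 0 survives the removal of the maximum; here
      \<open>A \<noteq> {0}\<close> enters.\<close>
    have "Max A \<noteq> 0"
    proof
      assume "Max A = 0"
      then have "A \<subseteq> {0}" using Max_ge[OF fin] by auto
      with \<open>0 \<in> A\<close> * show False by blast
    qed
    with \<open>0 \<in> A\<close> have B: "finite ?B" "0 \<in> ?B" using fin by auto
    then have "Max ?B \<in> ?B" by (intro Max_in) auto
    \<comment> \<open>Strictness shows that cutting \<open>A\<close> at \<open>Max ?B\<close> drops
      \<open>Max A\<close>, while every \<open>n\<close> up to the cut stays in the range of
      \<open>rep\<close>.\<close>
    with Max_ge[OF fin] have less: "Max ?B < Max A" by (simp add: le_neq_implies_less)
    show "finite_R_basis_of_order R H ?B"
    proof (rule finite_R_basis_of_order_restrict[where A = A])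
      show "?B = A \<inter> {0..Max ?B}"
        using less Max_ge[OF B(1)] by fastforce
      show "rep_sum A n (H n) \<in> R n" if "n \<le> Max ?B" for n
        using less that by (intro rep) simp
    qed (rule B)+
  }
qed

end
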